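(* Let $n$ be a positive integer. The free monogenic inverse monoid $\mathcal{I}$ embeds (as a semigroup) in $UT_n(\mathbb{T})$ if and only if $n\ge 3$.
   Context: The tropical semiring $\mathbb{T}$ is the set $\mathbb{R}\cup\{-\infty\}$ with operations $a\oplus b=\max(a,b)$ and $a\otimes b=a+b$, where $-\infty\oplus a=a$ and $-\infty\otimes a=-\infty$. $UT_n(\mathbb{T})$ is the monoid of all $n\times n$ matrices over $\mathbb{T}$ with all entries below the main diagonal equal to $-\infty$, under the matrix multiplication induced by $\oplus$ and $\otimes$. The free monogenic inverse monoid $\mathcal{I}$ is the free one-generated object in the category of inverse monoids. It is isomorphic to the set $\{(i,j,k)\in\mathbb{Z}^3\mid i,j\ge 0,\ -j\le k\le i\}$ with multiplication $$(i,j,k)(i',j',k')=(\max(i,i'+k),\ \max(j,j'-k),\ k+k').$$ An embedding of semigroups is an injective semigroup morphism. *)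

theory Defs
  imports Complex_Main "HOL-Algebra.Group" "Jordan_Normal_Form.Matrix"
begin

section \<open>The tropical semiring\<close>

datatype tropical = MInf | Fin real

text \<open>
  The semiring operations \<open>+\<close> and \<open>*\<close> of this instance are the tropical ones:
  \<open>+\<close> is the maximum and \<open>*\<close> is real addition. Accordingly the semiring zero is
  \<open>MInf\<close> (that is, \<open>-\<infinity>\<close>) and the semiring one is the real number 0.
\<close>

instantiation tropical :: comm_semiring_1
begin

definition zero_tropical :: tropical where
  "zero_tropical = MInf"

definition one_tropical :: tropical where
  "one_tropical = Fin 0"

fun plus_tropical :: "tropical \<Rightarrow> tropical \<Rightarrow> tropical" where
  "plus_tropical MInf b = b"
| "plus_tropical (Fin x) MInf = Fin x"
| "plus_tropical (Fin x) (Fin y) = Fin (max x y)"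

fun times_tropical :: "tropical \<Rightarrow> tropical \<Rightarrow> tropical" where
  "times_tropical MInf b = MInf"
| "times_tropical (Fin x) MInf = MInf"
| "times_tropical (Fin x) (Fin y) = Fin (x + y)"

instance
proof
  fix a b c :: tropical
  show "a + b + c = a + (b + c)" by (cases a; cases b; cases c) auto
  show "a + b = b + a" by (cases a; cases b) auto
  show "0 + a = a" by (simp add: zero_tropical_def)
  show "a * b * c = a * (b * c)" by (cases a; cases b; cases c) auto
  show "a * b = b * a" by (cases a; cases b) auto
  show "1 * a = a" by (cases a) (auto simp: one_tropical_def)
  show "(a + b) * c = a * c + b * c" by (cases a; cases b; cases c) auto
  show "0 * a = 0" "a * 0 = 0" by (cases a; simp add: zero_tropical_def)+
  show "(0::tropical) \<noteq> 1" by (simp add: zero_tropical_def one_tropical_def)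
qed

end

section \<open>Upper triangular tropical matrices\<close>

text \<open>
  In \<^const>\<open>upper_triangular\<close> the entries below the diagonal are required to be the semiring
  zero, which for \<^typ>\<open>tropical\<close> is \<open>MInf\<close>; entries on and above the diagonal are
  arbitrary. The product of matrices is formed with the tropical \<open>+\<close> and \<open>*\<close>.
\<close>

definition UT :: "nat \<Rightarrow> tropical mat monoid" where
  "UT n = \<lparr>carrier = {A \<in> carrier_mat n n. upper_triangular A}, mult = (*), one = 1\<^sub>m n\<rparr>"

lemma monoid_UT: "monoid (UT n)"
proof (rule monoidI)
  fix A B assume "A \<in> carrier (UT n)" "B \<in> carrier (UT n)"
  then have A: "A \<in> carrier_mat n n" "upper_triangular A"
    and B: "B \<in> carrier_mat n n" "upper_triangular B" by (auto simp: UT_def)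
  have "(A * B) $$ (i, j) = 0" if "j < i" "i < n" for i j
  proof -
    have "A $$ (i, k) * B $$ (k, j) = 0" if "k < n" for k
    proof (cases "k < i")
      case True
      then have "A $$ (i, k) = 0" using A \<open>i < n\<close> by auto
      then show ?thesis by simp
    next
      case False
      then have "B $$ (k, j) = 0" using B \<open>j < i\<close> \<open>k < n\<close> by auto
      then show ?thesis by simp
    qed
    then show ?thesis using A B that by (simp add: scalar_prod_def)
  qed
  then have "upper_triangular (A * B)" using A by (intro upper_triangularI) auto
  then show "A \<otimes>\<^bsub>UT n\<^esub> B \<in> carrier (UT n)" using A B by (auto simp: UT_def)
qed (auto simp: UT_def)

section \<open>Inverse monoids\<close>

locale inverse_monoid = monoid G for G (structure) +
  assumes unique_inverse:
    "x \<in> carrier G \<Longrightarrow> \<exists>!y. y \<in> carrier G \<and> x \<otimes> y \<otimes> x = x \<and> y \<otimes> x \<otimes> y = y"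

section \<open>The free monogenic inverse monoid\<close>

text \<open>
  \<open>FIM\<close> is the concrete model by integer triples. The theorem \<open>FIM_free\<close> below shows that it
  is indeed the free inverse monoid on the one generator \<open>FIM_gen\<close>.
\<close>

definition FIM :: "(int \<times> int \<times> int) monoid" where
  "FIM = \<lparr>carrier = {(i, j, k). 0 \<le> i \<and> 0 \<le> j \<and> - j \<le> k \<and> k \<le> i},
          mult = (\<lambda>(i, j, k) (i', j', k'). (max i (i' + k), max j (j' - k), k + k')),
          one = (0, 0, 0)\<rparr>"

definition FIM_gen :: "int \<times> int \<times> int" where
  "FIM_gen = (1, 0, 1)"

lemma FIM_simps:
  "(i, j, k) \<in> carrier FIM \<longleftrightarrow> 0 \<le> i \<and> 0 \<le> j \<and> - j \<le> k \<and> k \<le> i"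
  "(i, j, k) \<otimes>\<^bsub>FIM\<^esub> (i', j', k') = (max i (i' + k), max j (j' - k), k + k')"
  "\<one>\<^bsub>FIM\<^esub> = (0, 0, 0)"
  by (auto simp: FIM_def)

lemma monoid_FIM: "monoid FIM"
  by (rule monoidI) (auto simp: FIM_def)

theorem inverse_monoid_FIM: "inverse_monoid FIM"
proof -
  interpret monoid FIM by (rule monoid_FIM)
  show ?thesis
  proof
    fix x assume "x \<in> carrier FIM"
    moreover obtain i j k where x: "x = (i, j, k)" by (cases x)
    ultimately have ijk: "0 \<le> i" "0 \<le> j" "- j \<le> k" "k \<le> i" by (auto simp: FIM_simps)
    show "\<exists>!y. y \<in> carrier FIM \<and> x \<otimes>\<^bsub>FIM\<^esub> y \<otimes>\<^bsub>FIM\<^esub> x = x \<and> y \<otimes>\<^bsub>FIM\<^esub> x \<otimes>\<^bsub>FIM\<^esub> y = y"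
    proof (rule ex1I[of _ "(i - k, j + k, - k)"])
      show "(i - k, j + k, - k) \<in> carrier FIM \<and>
          x \<otimes>\<^bsub>FIM\<^esub> (i - k, j + k, - k) \<otimes>\<^bsub>FIM\<^esub> x = x \<and>
          (i - k, j + k, - k) \<otimes>\<^bsub>FIM\<^esub> x \<otimes>\<^bsub>FIM\<^esub> (i - k, j + k, - k) = (i - k, j + k, - k)"
        using ijk by (auto simp: x FIM_simps)
    next
      fix y assume y: "y \<in> carrier FIM \<and> x \<otimes>\<^bsub>FIM\<^esub> y \<otimes>\<^bsub>FIM\<^esub> x = x \<and> y \<otimes>\<^bsub>FIM\<^esub> x \<otimes>\<^bsub>FIM\<^esub> y = y"
      obtain a b c where "y = (a, b, c)" by (cases y)
      with y ijk show "y = (i - k, j + k, - k)" by (auto simp: x FIM_simps)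
    qed
  qed
qed

lemma FIM_gen_closed: "FIM_gen \<in> carrier FIM"
  by (simp add: FIM_gen_def FIM_simps)

lemma FIM_induct [consumes 1, case_names one gen inv]:
  assumes a: "a \<in> carrier FIM"
    and one: "Q (0, 0, 0)"
    and gen: "\<And>b. b \<in> carrier FIM \<Longrightarrow> Q b \<Longrightarrow> Q ((1, 0, 1) \<otimes>\<^bsub>FIM\<^esub> b)"
    and inv: "\<And>b. b \<in> carrier FIM \<Longrightarrow> Q b \<Longrightarrow> Q ((0, 1, -1) \<otimes>\<^bsub>FIM\<^esub> b)"
  shows "Q a"
proof -
  have 1: "Q (0, int m, - int m)" for m
  proof (induction m)
    case (Suc m)
    from inv[OF _ Suc] show ?case by (simp add: FIM_simps add.commute)
  qed (use one in simp)
  have 2: "Q (int m, max 0 (int n - int m), int m - int n)" for m n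
  proof (induction m)
    case (Suc m)
    have "max 0 (max 0 (int n - int m) - 1) = max 0 (int n - int (Suc m))" by simp
    with gen[OF _ Suc] show ?case by (simp add: FIM_simps algebra_simps)
  qed (use 1 in simp)
  have 3: "Q (int r - int m, int m, int r - int n - int m)" if "n \<le> r" "m \<le> r" for n m r
    using that
  proof (induction m)
    case 0
    then show ?case using 2[of r n] by (cases "r = n") (simp_all add: max_def)
  next
    case (Suc m)
    have "(int r - int m, int m, int r - int n - int m) \<in> carrier FIM"
      using Suc.prems by (simp add: FIM_simps)
    moreover have "Q (int r - int m, int m, int r - int n - int m)"
      using Suc by simp
    ultimately have "Q ((0, 1, -1) \<otimes>\<^bsub>FIM\<^esub> (int r - int m, int m, int r - int n - int m))"
      by (rule inv)
    moreover have "(0, 1, -1) \<otimes>\<^bsub>FIM\<^esub> (int r - int m, int m, int r - int n - int m)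
        = (int r - int (Suc m), int (Suc m), int r - int n - int (Suc m))"
      using Suc.prems by (simp add: FIM_simps)
    ultimately show ?case by simp
  qed
  obtain i j k where ijk: "a = (i, j, k)" by (cases a)
  with a have *: "0 \<le> i" "0 \<le> j" "- j \<le> k" "k \<le> i" by (auto simp: FIM_simps)
  then show ?thesis using 3[of "nat (i - k)" "nat (i + j)" "nat j"] by (simp add: ijk)
qed

text \<open>
  Given mutually inverse \<open>x\<close> and \<open>y\<close>, the morphism from \<open>FIM\<close> sending the generator to \<open>x\<close>
  maps \<open>(i, j, k)\<close> to \<open>x\<^sup>i y\<^sup>i \<cdot> y\<^sup>j x\<^sup>j \<cdot> x\<^sup>k\<close>, where negative powers of \<open>x\<close> are powers of \<open>y\<close>
  (\<open>FIM_lift\<close> below).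
\<close>

context inverse_monoid
begin

declare pow_nat [simp del]

definition inverses :: "'a \<Rightarrow> 'a \<Rightarrow> bool" where
  "inverses x y \<longleftrightarrow> x \<in> carrier G \<and> y \<in> carrier G \<and> x \<otimes> y \<otimes> x = x \<and> y \<otimes> x \<otimes> y = y"

lemma inverses_ex: "x \<in> carrier G \<Longrightarrow> \<exists>y. inverses x y"
  using unique_inverse[of x] unfolding inverses_def by blast

lemma inverses_unique: "inverses x y \<Longrightarrow> inverses x z \<Longrightarrow> y = z"
  using unique_inverse[of x] unfolding inverses_def by blast

lemma inverses_sym: "inverses x y \<Longrightarrow> inverses y x"
  by (simp add: inverses_def)

lemma idem_mult:
  assumes e: "e \<in> carrier G" "e \<otimes> e = e" and f: "f \<in> carrier G" "f \<otimes> f = f"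
  shows "e \<otimes> f \<otimes> (e \<otimes> f) = e \<otimes> f"
proof -
  have ee: "e \<otimes> (e \<otimes> u) = e \<otimes> u" if "u \<in> carrier G" for u
    using e that by (metis m_assoc)
  have ff: "f \<otimes> (f \<otimes> u) = f \<otimes> u" if "u \<in> carrier G" for u
    using f that by (metis m_assoc)
  obtain x where x: "inverses (e \<otimes> f) x" using inverses_ex e f by blast
  then have xc: "x \<in> carrier G" and x1: "e \<otimes> (f \<otimes> (x \<otimes> (e \<otimes> f))) = e \<otimes> f"
    and x2: "x \<otimes> (e \<otimes> (f \<otimes> x)) = x"
    using e f by (auto simp: inverses_def m_assoc)
  have x3: "x \<otimes> (e \<otimes> (f \<otimes> (x \<otimes> u))) = x \<otimes> u" if "u \<in> carrier G" for u
    using arg_cong[OF x2, of "\<lambda>v. v \<otimes> u"] that e f xc by (simp add: m_assoc)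
  have "inverses (e \<otimes> f) (f \<otimes> x \<otimes> e)"
    using e f xc x1 by (simp add: inverses_def m_assoc ee ff x3)
  then have fxe: "f \<otimes> x \<otimes> e = x" using x inverses_unique by blast
  have "x \<otimes> x = f \<otimes> x \<otimes> e \<otimes> (f \<otimes> x \<otimes> e)" using fxe by simp
  also have "\<dots> = f \<otimes> x \<otimes> e" using e f xc by (simp add: m_assoc x3)
  finally have "x \<otimes> x = x" using fxe by simp
  then have "inverses x x" using xc by (simp add: inverses_def)
  then have "e \<otimes> f = x" using x inverses_sym inverses_unique by blast
  with \<open>x \<otimes> x = x\<close> show ?thesis by simp
qed

lemma idem_commute:
  assumes e: "e \<in> carrier G" "e \<otimes> e = e" and f: "f \<in> carrier G" "f \<otimes> f = f"
  shows "e \<otimes> f = f \<otimes> e"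
proof -
  have ee: "e \<otimes> (e \<otimes> u) = e \<otimes> u" if "u \<in> carrier G" for u
    using e that by (metis m_assoc)
  have ff: "f \<otimes> (f \<otimes> u) = f \<otimes> u" if "u \<in> carrier G" for u
    using f that by (metis m_assoc)
  note 1 = idem_mult[OF e f] and 2 = idem_mult[OF f e]
  have "inverses (e \<otimes> f) (e \<otimes> f)" unfolding inverses_def 1 using 1 e f by blast
  moreover have "inverses (e \<otimes> f) (f \<otimes> e)"
    using e f 1 2 by (simp add: inverses_def m_assoc ee ff)
  ultimately show ?thesis by (rule inverses_unique)
qed

lemma inverses_idem:
  assumes "inverses x y"
  shows "x \<otimes> y \<in> carrier G" "x \<otimes> y \<otimes> (x \<otimes> y) = x \<otimes> y"
proof -
  show "x \<otimes> y \<in> carrier G" using assms by (simp add: inverses_def)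
  have "x \<otimes> y \<otimes> (x \<otimes> y) = x \<otimes> y \<otimes> x \<otimes> y" using assms by (simp add: inverses_def m_assoc[symmetric])
  then show "x \<otimes> y \<otimes> (x \<otimes> y) = x \<otimes> y" using assms by (simp only: inverses_def)
qed

lemma inverses_commute:
  assumes "inverses x y" "inverses u v"
  shows "x \<otimes> y \<otimes> (u \<otimes> v) = u \<otimes> v \<otimes> (x \<otimes> y)"
  using inverses_idem[OF assms(1)] inverses_idem[OF assms(2)] by (rule idem_commute)

lemma inverses_mult:
  assumes "inverses x y" "inverses u v"
  shows "inverses (x \<otimes> u) (v \<otimes> y)"
proof -
  have c: "x \<in> carrier G" "y \<in> carrier G" "u \<in> carrier G" "v \<in> carrier G"
    using assms by (auto simp: inverses_def)
  have com: "u \<otimes> v \<otimes> (y \<otimes> x) = y \<otimes> x \<otimes> (u \<otimes> v)"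
    by (rule inverses_commute[OF assms(2) inverses_sym[OF assms(1)]])
  have "x \<otimes> u \<otimes> (v \<otimes> y) \<otimes> (x \<otimes> u) = x \<otimes> (u \<otimes> v \<otimes> (y \<otimes> x)) \<otimes> u"
    using c by (simp add: m_assoc)
  also have "\<dots> = (x \<otimes> y \<otimes> x) \<otimes> (u \<otimes> v \<otimes> u)"
    unfolding com using c by (simp add: m_assoc)
  finally have 1: "x \<otimes> u \<otimes> (v \<otimes> y) \<otimes> (x \<otimes> u) = x \<otimes> u"
    using assms by (simp add: inverses_def)
  have "v \<otimes> y \<otimes> (x \<otimes> u) \<otimes> (v \<otimes> y) = v \<otimes> (y \<otimes> x \<otimes> (u \<otimes> v)) \<otimes> y"
    using c by (simp add: m_assoc)
  also have "\<dots> = (v \<otimes> u \<otimes> v) \<otimes> (y \<otimes> x \<otimes> y)"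
    unfolding com[symmetric] using c by (simp add: m_assoc)
  finally have 2: "v \<otimes> y \<otimes> (x \<otimes> u) \<otimes> (v \<otimes> y) = v \<otimes> y"
    using assms by (simp add: inverses_def)
  show ?thesis using 1 2 c by (simp add: inverses_def)
qed

lemma inverses_pow:
  assumes "inverses x y"
  shows "inverses (x [^] (m::nat)) (y [^] m)"
proof (induction m)
  case 0
  show ?case by (simp add: inverses_def)
next
  case (Suc m)
  have "y [^] Suc m = y \<otimes> y [^] m"
    using assms by (intro nat_pow_Suc2) (simp add: inverses_def)
  then show ?case using inverses_mult[OF Suc assms] by simp
qed

definition rangeidem :: "'a \<Rightarrow> 'a \<Rightarrow> int \<Rightarrow> 'a" where
  "rangeidem x y i = x [^] nat i \<otimes> y [^] nat i"

definition spow :: "'a \<Rightarrow> 'a \<Rightarrow> int \<Rightarrow> 'a" where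
  "spow x y k = (if 0 \<le> k then x [^] nat k else y [^] nat (- k))"

definition FIM_lift :: "'a \<Rightarrow> 'a \<Rightarrow> int \<times> int \<times> int \<Rightarrow> 'a" where
  "FIM_lift x y = (\<lambda>(i, j, k). rangeidem x y i \<otimes> rangeidem y x j \<otimes> spow x y k)"

lemma nat_add_one:
  assumes "0 \<le> (i::int)"
  shows "nat (i + 1) = Suc (nat i)"
  using assms by simp

context
  fixes x y
  assumes xy: "inverses x y"
begin

lemma cx: "x \<in> carrier G" and cy: "y \<in> carrier G"
  using xy by (auto simp: inverses_def)

lemma rangeidem_idem:
  "rangeidem x y i \<in> carrier G" "rangeidem x y i \<otimes> rangeidem x y i = rangeidem x y i"
  unfolding rangeidem_def using inverses_pow[OF xy] by (auto intro: inverses_idem)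

lemma spow_closed: "spow x y k \<in> carrier G"
  using cx cy by (simp add: spow_def)

lemma mult_rangeidem:
  assumes "0 \<le> i"
  shows "x \<otimes> rangeidem x y i = rangeidem x y (i + 1) \<otimes> x"
proof -
  let ?m = "nat i"
  have c: "x [^] ?m \<in> carrier G" "y [^] ?m \<in> carrier G" using cx cy by auto
  have com: "x [^] ?m \<otimes> y [^] ?m \<otimes> (y \<otimes> x) = y \<otimes> x \<otimes> (x [^] ?m \<otimes> y [^] ?m)"
    by (rule inverses_commute[OF inverses_pow[OF xy] inverses_sym[OF xy]])
  have "rangeidem x y (i + 1) \<otimes> x = (x \<otimes> x [^] ?m) \<otimes> (y [^] ?m \<otimes> y) \<otimes> x"
    using assms cx by (simp add: rangeidem_def nat_add_one nat_pow_Suc2[symmetric] del: nat_pow_Suc)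
  also have "\<dots> = x \<otimes> (x [^] ?m \<otimes> y [^] ?m \<otimes> (y \<otimes> x))"
    using c cx cy by (simp add: m_assoc)
  also have "\<dots> = (x \<otimes> y \<otimes> x) \<otimes> (x [^] ?m \<otimes> y [^] ?m)"
    unfolding com using c cx cy by (simp add: m_assoc)
  finally show ?thesis using xy by (simp add: inverses_def rangeidem_def)
qed

lemma mult_rangeidem':
  assumes "0 \<le> j"
  shows "x \<otimes> rangeidem y x j = rangeidem y x (j - 1) \<otimes> x"
proof (cases "j = 0")
  case True
  then show ?thesis using cx by (simp add: rangeidem_def)
next
  case False
  let ?m = "nat (j - 1)"
  have c: "x [^] ?m \<in> carrier G" "y [^] ?m \<in> carrier G" using cx cy by auto
  have com: "y [^] ?m \<otimes> x [^] ?m \<otimes> (x \<otimes> y) = x \<otimes> y \<otimes> (y [^] ?m \<otimes> x [^] ?m)"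
    by (rule inverses_commute[OF inverses_sym[OF inverses_pow[OF xy]] xy])
  have m: "nat j = Suc ?m" using assms False by simp
  have "x \<otimes> rangeidem y x j = x \<otimes> ((y \<otimes> y [^] ?m) \<otimes> (x [^] ?m \<otimes> x))"
    unfolding rangeidem_def m using cy by (simp add: nat_pow_Suc2[symmetric])
  also have "\<dots> = x \<otimes> y \<otimes> (y [^] ?m \<otimes> x [^] ?m) \<otimes> x"
    using c cx cy by (simp add: m_assoc)
  also have "\<dots> = y [^] ?m \<otimes> x [^] ?m \<otimes> (x \<otimes> y \<otimes> x)"
    unfolding com[symmetric] using c cx cy by (simp add: m_assoc)
  finally show ?thesis using xy by (simp add: inverses_def rangeidem_def)
qed

lemma rangeidem_absorb:
  assumes "0 \<le> i"
  shows "rangeidem x y (i + 1) \<otimes> (x \<otimes> y) = rangeidem x y (i + 1)"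
proof -
  have c: "x [^] nat i \<in> carrier G" "y [^] nat i \<in> carrier G" using cx cy by auto
  have "y \<otimes> (x \<otimes> y) = y" using xy by (simp add: inverses_def m_assoc[symmetric])
  then show ?thesis
    using assms c cx cy by (simp add: rangeidem_def nat_add_one m_assoc)
qed

lemma mult_spow:
  assumes "k < 0"
  shows "x \<otimes> spow x y k = x \<otimes> y \<otimes> spow x y (k + 1)"
proof -
  have "nat (- k) = Suc (nat (- k - 1))" using assms by simp
  then have "spow x y k = y \<otimes> y [^] nat (- k - 1)"
    using assms cy by (metis nat_pow_Suc2 not_less spow_def)
  also have "y [^] nat (- k - 1) = spow x y (k + 1)"
  proof (cases "k = -1")
    case False
    then have "\<not> 0 \<le> k + 1" "- (k + 1) = - k - 1" using assms by simp_all
    then show ?thesis by (simp only: spow_def if_False)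
  qed (simp add: spow_def)
  finally show ?thesis using cx cy spow_closed by (simp add: m_assoc)
qed

end

lemma rangeidem_commute:
  assumes "inverses x y"
  shows "rangeidem x y i \<otimes> rangeidem y x j = rangeidem y x j \<otimes> rangeidem x y i"
  using rangeidem_idem[OF assms] rangeidem_idem[OF inverses_sym[OF assms]] by (intro idem_commute)

lemma FIM_lift_step:
  assumes xy: "inverses x y" and ij: "0 \<le> i" "0 \<le> j"
  shows "FIM_lift x y (i + 1, max 0 (j - 1), k + 1) = x \<otimes> FIM_lift x y (i, j, k)"
proof -
  note c = cx[OF xy] cy[OF xy] spow_closed[OF xy] rangeidem_idem(1)[OF xy]
    rangeidem_idem(1)[OF inverses_sym[OF xy]]
  let ?P = "rangeidem x y (i + 1)" and ?Q = "rangeidem y x (j - 1)"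
  have Q: "rangeidem y x (max 0 (j - 1)) = ?Q" by (auto simp: rangeidem_def max_def)
  have "x \<otimes> FIM_lift x y (i, j, k) = (x \<otimes> rangeidem x y i) \<otimes> rangeidem y x j \<otimes> spow x y k"
    using c by (simp add: FIM_lift_def m_assoc)
  also have "\<dots> = ?P \<otimes> (x \<otimes> rangeidem y x j) \<otimes> spow x y k"
    unfolding mult_rangeidem[OF xy ij(1)] using c by (simp add: m_assoc)
  also have "\<dots> = ?P \<otimes> ?Q \<otimes> (x \<otimes> spow x y k)"
    unfolding mult_rangeidem'[OF xy ij(2)] using c by (simp add: m_assoc)
  also have "\<dots> = ?P \<otimes> ?Q \<otimes> spow x y (k + 1)"
  proof (cases "k < 0")
    case True
    have "?P \<otimes> ?Q \<otimes> (x \<otimes> spow x y k) = ?Q \<otimes> (?P \<otimes> (x \<otimes> y)) \<otimes> spow x y (k + 1)"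
      unfolding mult_spow[OF xy True] rangeidem_commute[OF xy] using c by (simp add: m_assoc)
    then show ?thesis unfolding rangeidem_absorb[OF xy ij(1)] rangeidem_commute[OF xy] .
  next
    case False
    then have "spow x y (k + 1) = x \<otimes> spow x y k"
      using c by (simp add: spow_def nat_add_one nat_pow_Suc2[symmetric] del: nat_pow_Suc)
    then show ?thesis by simp
  qed
  finally show ?thesis by (simp add: FIM_lift_def Q)
qed

lemma FIM_lift_swap:
  assumes "inverses x y"
  shows "FIM_lift x y (i, j, k) = FIM_lift y x (j, i, - k)"
  using rangeidem_commute[OF assms] by (auto simp: FIM_lift_def spow_def)

lemma FIM_lift_step':
  assumes xy: "inverses x y" and ij: "0 \<le> i" "0 \<le> j"
  shows "FIM_lift x y (max 0 (i - 1), j + 1, k - 1) = y \<otimes> FIM_lift x y (i, j, k)"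
  using FIM_lift_step[OF inverses_sym[OF xy] ij(2,1), of "- k"] FIM_lift_swap[OF xy] by simp

lemma FIM_lift_gen_mult:
  assumes xy: "inverses x y" and b: "b \<in> carrier FIM"
  shows "FIM_lift x y ((1, 0, 1) \<otimes>\<^bsub>FIM\<^esub> b) = x \<otimes> FIM_lift x y b"
    and "FIM_lift x y ((0, 1, -1) \<otimes>\<^bsub>FIM\<^esub> b) = y \<otimes> FIM_lift x y b"
proof -
  obtain i j k where bijk: "b = (i, j, k)" by (cases b)
  with b have ij: "0 \<le> i" "0 \<le> j" by (auto simp: FIM_simps)
  then have "(1, 0, 1) \<otimes>\<^bsub>FIM\<^esub> b = (i + 1, max 0 (j - 1), k + 1)"
    "(0, 1, -1) \<otimes>\<^bsub>FIM\<^esub> b = (max 0 (i - 1), j + 1, k - 1)"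
    by (auto simp: FIM_simps bijk)
  then show "FIM_lift x y ((1, 0, 1) \<otimes>\<^bsub>FIM\<^esub> b) = x \<otimes> FIM_lift x y b"
    and "FIM_lift x y ((0, 1, -1) \<otimes>\<^bsub>FIM\<^esub> b) = y \<otimes> FIM_lift x y b"
    using FIM_lift_step[OF xy ij] FIM_lift_step'[OF xy ij] by (simp_all add: bijk)
qed

lemma FIM_lift_closed:
  assumes "inverses x y"
  shows "FIM_lift x y a \<in> carrier G"
  using spow_closed[OF assms] rangeidem_idem(1)[OF assms]
    rangeidem_idem(1)[OF inverses_sym[OF assms]]
  by (cases a) (simp add: FIM_lift_def)

lemma FIM_lift_one: "FIM_lift x y (0, 0, 0) = \<one>"
  by (simp add: FIM_lift_def rangeidem_def spow_def)

lemma FIM_lift_mult: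
  assumes xy: "inverses x y" and a: "a \<in> carrier FIM" and b: "b \<in> carrier FIM"
  shows "FIM_lift x y (a \<otimes>\<^bsub>FIM\<^esub> b) = FIM_lift x y a \<otimes> FIM_lift x y b"
  using a
proof (induction rule: FIM_induct)
  case one
  have "(0, 0, 0) \<otimes>\<^bsub>FIM\<^esub> b = b" using monoid.l_one[OF monoid_FIM b] by (simp add: FIM_simps)
  then show ?case using FIM_lift_closed[OF xy] by (simp add: FIM_lift_one)
next
  case (gen a)
  have "FIM_lift x y ((1, 0, 1) \<otimes>\<^bsub>FIM\<^esub> a \<otimes>\<^bsub>FIM\<^esub> b) = x \<otimes> FIM_lift x y (a \<otimes>\<^bsub>FIM\<^esub> b)"
    using gen(1) b FIM_lift_gen_mult(1)[OF xy] monoid.m_closed[OF monoid_FIM]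
    by (subst monoid.m_assoc[OF monoid_FIM]) (auto simp: FIM_simps)
  then show ?case using gen FIM_lift_gen_mult(1)[OF xy] FIM_lift_closed[OF xy] cx[OF xy]
    by (simp add: m_assoc)
next
  case (inv a)
  have "FIM_lift x y ((0, 1, -1) \<otimes>\<^bsub>FIM\<^esub> a \<otimes>\<^bsub>FIM\<^esub> b) = y \<otimes> FIM_lift x y (a \<otimes>\<^bsub>FIM\<^esub> b)"
    using inv(1) b FIM_lift_gen_mult(2)[OF xy] monoid.m_closed[OF monoid_FIM]
    by (subst monoid.m_assoc[OF monoid_FIM]) (auto simp: FIM_simps)
  then show ?case using inv FIM_lift_gen_mult(2)[OF xy] FIM_lift_closed[OF xy] cy[OF xy]
    by (simp add: m_assoc)
qed

text \<open>
  The universal property. The target monoid \<open>G\<close> is an arbitrary inverse monoid over an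
  arbitrary type. Monoid morphisms between inverse monoids preserve inverses automatically.
\<close>

theorem FIM_free:
  assumes g: "g \<in> carrier G"
  shows "\<exists>f. f \<in> hom FIM G \<and> f \<one>\<^bsub>FIM\<^esub> = \<one> \<and> f FIM_gen = g \<and>
    (\<forall>f'. f' \<in> hom FIM G \<and> f' \<one>\<^bsub>FIM\<^esub> = \<one> \<and> f' FIM_gen = g \<longrightarrow> (\<forall>a \<in> carrier FIM. f' a = f a))"
proof -
  obtain h where gh: "inverses g h" using inverses_ex[OF g] by blast
  let ?f = "FIM_lift g h"
  have "?f \<in> hom FIM G"
    using FIM_lift_closed[OF gh] FIM_lift_mult[OF gh] by (auto simp: hom_def)
  moreover have "?f FIM_gen = g"
    using FIM_lift_gen_mult(1)[OF gh, of "(0, 0, 0)"] g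
    by (simp add: FIM_gen_def FIM_lift_one FIM_simps)
  moreover have "f' a = ?f a"
    if f': "f' \<in> hom FIM G" "f' \<one>\<^bsub>FIM\<^esub> = \<one>" "f' FIM_gen = g" and a: "a \<in> carrier FIM" for f' a
  proof -
    let ?x = "(1, 0, 1) :: int \<times> int \<times> int" and ?y = "(0, 1, -1) :: int \<times> int \<times> int"
    have mult: "f' (u \<otimes>\<^bsub>FIM\<^esub> v) = f' u \<otimes> f' v" if "u \<in> carrier FIM" "v \<in> carrier FIM" for u v
      using f'(1) that by (rule hom_mult)
    have xy: "?x \<in> carrier FIM" "?y \<in> carrier FIM" by (auto simp: FIM_simps)
    have x: "f' ?x = g" using f'(3) by (simp add: FIM_gen_def)
    have "?x \<otimes>\<^bsub>FIM\<^esub> ?y \<otimes>\<^bsub>FIM\<^esub> ?x = ?x" "?y \<otimes>\<^bsub>FIM\<^esub> ?x \<otimes>\<^bsub>FIM\<^esub> ?y = ?y" by (auto simp: FIM_simps)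
    then have "inverses g (f' ?y)"
      using mult xy x monoid.m_closed[OF monoid_FIM] f'(1) g
      unfolding inverses_def by (metis hom_in_carrier)
    then have y: "f' ?y = h" using gh inverses_unique by blast
    show ?thesis using a
    proof (induction rule: FIM_induct)
      case one
      then show ?case using f'(2) by (simp add: FIM_lift_one FIM_simps)
    next
      case (gen b)
      then show ?case using mult[OF xy(1)] x FIM_lift_gen_mult(1)[OF gh] by simp
    next
      case (inv b)
      then show ?case using mult[OF xy(2)] y FIM_lift_gen_mult(2)[OF gh] by simp
    qed
  qed
  moreover have "?f \<one>\<^bsub>FIM\<^esub> = \<one>" by (simp add: FIM_simps(3) FIM_lift_one)
  ultimately show ?thesis by blast
qed

end

end

theory Submission
  imports Defs
begin

text \<open>
  For \<open>n \<ge> 3\<close> the maps \<open>(i, j, k) \<mapsto> [[k, i], [-\<infinity>, 0]]\<close> and \<open>(i, j, k) \<mapsto> [[-k, j], [-\<infinity>, 0]]\<close> are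
  morphisms, jointly injective; they share the diagonal entry 0 and so fit together in one
  \<open>3 \<times> 3\<close> matrix. For \<open>n \<le> 2\<close>, whenever \<open>X Y X = X\<close> the elements \<open>X Y\<close> and \<open>Y X\<close> are comparable:
  their product is one of the two. In the free monogenic inverse monoid this fails for the
  generator and its inverse.
\<close>

lemma UT_simps:
  "A \<in> carrier (UT n) \<longleftrightarrow> A \<in> carrier_mat n n \<and> upper_triangular A"
  "A \<otimes>\<^bsub>UT n\<^esub> B = A * B"
  by (simp_all add: UT_def)

lemma tropical_zero_simps [simp]:
  "MInf + a = a" "a + MInf = a" "MInf * a = MInf" "a * MInf = MInf" for a :: tropical
  by (cases a; simp)+

text \<open>The two blocks occupy the index sets {0,2} and {1,2}; indices from 3 on are padding. The
  unit goes to a matrix with \<open>Fin 0\<close> at (0,2), so this is a morphism of semigroups, not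
  of monoids.\<close>

definition FIM_mat :: "nat \<Rightarrow> int \<times> int \<times> int \<Rightarrow> tropical mat" where
  "FIM_mat n = (\<lambda>(i, j, k). mat n n (\<lambda>rc.
     if rc = (0, 0) then Fin k
     else if rc = (0, 2) then Fin i
     else if rc = (1, 1) then Fin (- k)
     else if rc = (1, 2) then Fin j
     else if rc = (2, 2) then Fin 0
     else MInf))"

lemma FIM_mat_carrier: "FIM_mat n a \<in> carrier (UT n)"
  by (cases a) (auto simp: FIM_mat_def UT_simps zero_tropical_def)

lemma FIM_mat_mult:
  assumes n: "3 \<le> n"
  shows "FIM_mat n (a \<otimes>\<^bsub>FIM\<^esub> b) = FIM_mat n a * FIM_mat n b"
proof (rule eq_matI)
  obtain i j k i' j' k' where ab: "a = (i, j, k)" "b = (i', j', k')" by (cases a; cases b) auto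
  fix r c assume "r < dim_row (FIM_mat n a * FIM_mat n b)" "c < dim_col (FIM_mat n a * FIM_mat n b)"
  then have rc: "r < n" "c < n" by (simp_all add: FIM_mat_def ab)
  have "(FIM_mat n a * FIM_mat n b) $$ (r, c)
      = (\<Sum>l\<in>{0..<n}. FIM_mat n a $$ (r, l) * FIM_mat n b $$ (l, c))"
    using rc by (simp add: FIM_mat_def ab scalar_prod_def)
  \<comment> \<open>Padding columns of the left factor are \<open>MInf\<close>, the zero of the
    sum.\<close>
  also have "\<dots> = (\<Sum>l\<in>{0, 1, 2}. FIM_mat n a $$ (r, l) * FIM_mat n b $$ (l, c))"
    using rc n by (intro sum.mono_neutral_right) (auto simp: FIM_mat_def ab zero_tropical_def)
  also have "\<dots> = FIM_mat n (a \<otimes>\<^bsub>FIM\<^esub> b) $$ (r, c)"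
    using rc n by (auto simp: FIM_mat_def ab FIM_simps max_def)
  finally show "FIM_mat n (a \<otimes>\<^bsub>FIM\<^esub> b) $$ (r, c) = (FIM_mat n a * FIM_mat n b) $$ (r, c)" ..
qed (auto simp: FIM_mat_def split: prod.split)

lemma FIM_mat_inj:
  assumes n: "3 \<le> n"
  shows "inj (FIM_mat n)"
proof (rule injI)
  fix a b assume eq: "FIM_mat n a = FIM_mat n b"
  obtain i j k i' j' k' where ab: "a = (i, j, k)" "b = (i', j', k')" by (cases a; cases b) auto
  have "FIM_mat n a $$ (0, 0) = FIM_mat n b $$ (0, 0)" "FIM_mat n a $$ (0, 2) = FIM_mat n b $$ (0, 2)"
    "FIM_mat n a $$ (1, 2) = FIM_mat n b $$ (1, 2)"
    by (simp_all add: eq)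
  then show "a = b" using n by (simp add: FIM_mat_def ab)
qed

lemma FIM_mat_mon: "3 \<le> n \<Longrightarrow> FIM_mat n \<in> mon FIM (UT n)"
  using FIM_mat_carrier FIM_mat_mult FIM_mat_inj
  by (auto simp: mon_def hom_def UT_simps(2) intro: inj_on_subset[OF _ subset_UNIV])

text \<open>A finite diagonal entry of \<open>X\<close> forces its negative in \<open>Y\<close>, so
  \<open>X * Y\<close> and \<open>Y * X\<close> share a diagonal of zeros and \<open>MInf\<close>;
  in size two only the corners can differ. If both diagonal entries are 0, the product has the
  maximum of the corners; if one is, it copies the corner of one factor; if none is,
  \<open>X\<close> itself is zero.\<close>

lemma UT_small_comparable:
  assumes n: "n = 1 \<or> n = 2"
    and X: "X \<in> carrier (UT n)" and Y: "Y \<in> carrier (UT n)" and XYX: "X * Y * X = X"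
  shows "X * Y * (Y * X) = X * Y \<or> X * Y * (Y * X) = Y * X"
proof -
  note dims = X[unfolded UT_simps] Y[unfolded UT_simps]
  consider "n = 1" | "n = 2" using n by blast
  then show ?thesis
  proof cases
    case 1
    have "X * Y = Y * X"
      using dims by (intro eq_matI) (auto simp: 1 scalar_prod_def mult.commute)
    then have "X * Y * (Y * X) = X * Y * X * Y"
      using dims by (metis assoc_mult_mat mult_carrier_mat)
    then show ?thesis by (simp add: XYX)
  next
    case 2
    have entry: "(A * B) $$ (r, c) = A $$ (r, 0) * B $$ (0, c) + A $$ (r, 1) * B $$ (1, c)"
      if "A \<in> carrier_mat 2 2" "B \<in> carrier_mat 2 2" "r < 2" "c < 2" for A B :: "tropical mat" and r c
      using that by (simp add: scalar_prod_def numeral_2_eq_2)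
    have mat_eq: "A = B \<longleftrightarrow> A $$ (0, 0) = B $$ (0, 0) \<and> A $$ (0, 1) = B $$ (0, 1) \<and>
        A $$ (1, 0) = B $$ (1, 0) \<and> A $$ (1, 1) = B $$ (1, 1)"
      if "A \<in> carrier_mat 2 2" "B \<in> carrier_mat 2 2" for A B :: "tropical mat"
      using that by (auto intro!: eq_matI simp: less_2_cases_iff)
    have X2: "X \<in> carrier_mat 2 2" "X $$ (Suc 0, 0) = MInf"
      and Y2: "Y \<in> carrier_mat 2 2" "Y $$ (Suc 0, 0) = MInf"
      using dims upper_triangularD[of X 0 1] upper_triangularD[of Y 0 1]
      by (auto simp: 2 zero_tropical_def)
    \<comment> \<open>Once it is known which of the six entries are \<open>MInf\<close>, everything
      reduces to maxima of real sums.\<close>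
    show ?thesis
      using XYX
      by (cases "X $$ (0, 0)"; cases "X $$ (0, 1)"; cases "X $$ (1, 1)";
          cases "Y $$ (0, 0)"; cases "Y $$ (0, 1)"; cases "Y $$ (1, 1)")
        (auto simp: mat_eq entry X2 Y2 mult_carrier_mat[of _ 2 2 _ 2] max_def)
  qed
qed

theorem proposition7p1:
  fixes n :: nat
  assumes "n \<ge> 1"
  shows "(\<exists>f. f \<in> mon FIM (UT n)) \<longleftrightarrow> n \<ge> 3"
proof
  assume "\<exists>f. f \<in> mon FIM (UT n)"
  then obtain f where f: "f \<in> hom FIM (UT n)" and inj: "inj_on f (carrier FIM)"
    by (auto simp: mon_def)
  \<comment> \<open>The generator and its inverse; \<open>?e\<close> and \<open>?f\<close> are the
    idempotents \<open>?x ?y\<close> and \<open>?y ?x\<close>, whose product (1, 1, 0) is neither of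
    them.\<close>
  let ?x = "(1, 0, 1) :: int \<times> int \<times> int" and ?y = "(0, 1, -1) :: int \<times> int \<times> int"
  let ?e = "(1, 0, 0) :: int \<times> int \<times> int" and ?f = "(0, 1, 0) :: int \<times> int \<times> int"
  have c: "?x \<in> carrier FIM" "?y \<in> carrier FIM" "?e \<in> carrier FIM" "?f \<in> carrier FIM"
    "(1, 1, 0) \<in> carrier FIM"
    by (auto simp: FIM_simps)
  have mult: "f a * f b = f (a \<otimes>\<^bsub>FIM\<^esub> b)" if "a \<in> carrier FIM" "b \<in> carrier FIM" for a b
    using hom_mult[OF f that] by (simp add: UT_simps)
  have prods: "f ?x * f ?y = f ?e" "f ?y * f ?x = f ?f" "f ?e * f ?x = f ?x"
    "f ?e * f ?f = f (1, 1, 0)"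
    using mult c by (simp_all add: FIM_simps(2))
  show "n \<ge> 3"
  proof (rule ccontr)
    assume "\<not> n \<ge> 3"
    with assms have "n = 1 \<or> n = 2" by auto
    \<comment> \<open>The premise \<open>X * Y * X = X\<close> is \<open>f ?e * f ?x = f ?x\<close>
      from \<open>prods\<close>.\<close>
    then have "f (1, 1, 0) = f ?e \<or> f (1, 1, 0) = f ?f"
      using UT_small_comparable[of n "f ?x" "f ?y"] hom_in_carrier[OF f] c prods by simp
    then show False using inj c by (auto dest: inj_onD)
  qed
next
  assume "n \<ge> 3"
  then show "\<exists>f. f \<in> mon FIM (UT n)" using FIM_mat_mon by blast
qed

end
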